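(* Let $\alpha\in[1/3,1)\cup\{0\}$ and, for integers $k\ge 3$, set $$b_k(\alpha):=\binom{\alpha}{k}-(-1)^k\binom{(1-\alpha)/2}{k}-\binom{(1+\alpha)/2}{k}.$$ Then $b_k(\alpha)\ge 0$ for all $k\ge 3$, and for every finitely supported function $u:\mathbb{N}_0\to\mathbb{R}$ with $u(0)=0$, $$\sum_{n=1}^\infty |u(n)-u(n-1)|^2 n^\alpha \;\ge\; \frac{(\alpha-1)^2}{4}\sum_{n=1}^\infty \frac{|u(n)|^2}{n^2}n^\alpha+\sum_{k=3}^\infty b_k(\alpha)\sum_{n=2}^\infty \frac{|u(n)|^2}{n^k}n^\alpha .$$
   Context: $\mathbb{N}_0=\{0,1,2,\dots\}$. For real $\gamma$ and a non-negative integer $k$, $\binom{\gamma}{k}=\frac{\gamma(\gamma-1)\cdots(\gamma-k+1)}{k!}$ is the generalized binomial coefficient. *)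

theory Defs
  imports "HOL-Analysis.Analysis"
begin

definition hardy_coeff :: "real \<Rightarrow> nat \<Rightarrow> real" where
  "hardy_coeff \<alpha> k =
     (\<alpha> gchoose k) - (-1) ^ k * (((1 - \<alpha>) / 2) gchoose k) - (((1 + \<alpha>) / 2) gchoose k)"

end

theory Submission
  imports Defs
begin

text \<open>
  The inequality is a ground state argument: for \<open>g n = n powr \<beta>\<close> with \<open>\<beta> = (1 - \<alpha>) / 2\<close>,
  each squared difference satisfies
  \<open>(u (n + 1) - u n)\<^sup>2 \<ge> (1 - g n / g (n + 1)) (u (n + 1))\<^sup>2 + (1 - g (n + 1) / g n) (u n)\<^sup>2\<close>.
  Summing with the weights \<open>n powr \<alpha>\<close> gives a Hardy inequality with weight \<open>n powr \<alpha> * W (1 / n)\<close>, where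
  \<open>W x = 1 + (1 + x) powr \<alpha> - (1 - x) powr \<beta> - (1 + x) powr \<gamma>\<close> and \<open>\<gamma> = (1 + \<alpha>) / 2\<close>.
  The binomial series turns \<open>W\<close> into \<open>(\<alpha> - 1)\<^sup>2 / 4 * x\<^sup>2 + (\<Sum>k\<ge>3. b\<^sub>k * x ^ k)\<close> for \<open>\<bar>x\<bar> < 1\<close>;
  at \<open>n = 1\<close> only the quadratic term is needed.
  For \<open>k \<ge> 3\<close>, the sign of \<open>b\<^sub>k\<close> follows from the convexity of \<open>x \<mapsto> (2 - x) \<cdots> (k - 1 - x)\<close>,
  because \<open>\<alpha>\<close> lies between \<open>\<beta>\<close> and \<open>\<gamma>\<close> when \<open>\<alpha> \<ge> 1/3\<close>; for \<open>\<alpha> = 0\<close> the first binomial coefficient vanishes.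
\<close>

text \<open>Used to exchange the series in \<open>k\<close> with the finite sum over the support of
  \<open>u\<close>.\<close>

lemma has_sum_sum:
  fixes f :: "'i \<Rightarrow> 'a \<Rightarrow> 'b::topological_comm_monoid_add"
  assumes "\<And>i. i \<in> I \<Longrightarrow> (f i has_sum s i) A"
  shows "((\<lambda>x. \<Sum>i\<in>I. f i x) has_sum (\<Sum>i\<in>I. s i)) A"
  using assms
proof (induction I rule: infinite_finite_induct)
  case (insert i I)
  then have "((\<lambda>x. f i x + (\<Sum>i\<in>I. f i x)) has_sum (s i + (\<Sum>i\<in>I. s i))) A"
    by (intro has_sum_add) simp_all
  then show ?case using insert.hyps by simp
qed (simp_all add: has_sum_0)

section \<open>Signs of the coefficients\<close>

text \<open>For \<open>x\<close> in [0,1] and \<open>k\<close> at least 1 this is the absolute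
  value, x (1 - x) ... (k - 1 - x) / k!. At \<open>k = 0\<close> it is -1.\<close>

definition abs_binom :: "real \<Rightarrow> nat \<Rightarrow> real" where
  "abs_binom x k = (-1) ^ Suc k * (x gchoose k)"

lemma abs_binom_Suc: "real (Suc k) * abs_binom x (Suc k) = (real k - x) * abs_binom x k"
proof -
  have "real (Suc k) * (x gchoose Suc k) = (x - real k) * (x gchoose k)"
    using gbinomial_mult_1[of x k] by (simp add: algebra_simps)
  then have "(-1) ^ k * (real (Suc k) * (x gchoose Suc k)) = (-1) ^ k * ((x - real k) * (x gchoose k))"
    by (rule arg_cong)
  then show ?thesis
    by (simp add: abs_binom_def algebra_simps)
qed

lemma abs_binom_2: "abs_binom x 2 = x * (1 - x) / 2"
  using abs_binom_Suc[of 1 x] by (simp add: abs_binom_def numeral_2_eq_2 field_simps)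

lemma abs_binom_nonneg:
  assumes "0 \<le> x" "x \<le> 1" "2 \<le> k"
  shows "0 \<le> abs_binom x k"
  using assms(3)
proof (induction k rule: dec_induct)
  case base
  then show ?case using assms by (simp add: abs_binom_2)
next
  case (step k)
  then have "0 \<le> real (Suc k) * abs_binom x (Suc k)"
    unfolding abs_binom_Suc using assms by simp
  then show ?case by (simp add: zero_le_mult_iff)
qed

text \<open>Both sides equal x (1 - x) / 2 at \<open>k = 2\<close>, and the factor (k - x) / (k + 1)
  of the recurrence is larger for the smaller argument.\<close>

lemma abs_binom_reflect_le:
  assumes "x + y = 1" "0 \<le> x" "x \<le> y" "2 \<le> k"
  shows "abs_binom y k \<le> abs_binom x k"
  using assms(4)
proof (induction k rule: dec_induct)
  case base
  have "y = 1 - x"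
    using assms by simp
  then show ?case by (simp add: abs_binom_2)
next
  case (step k)
  have "real (Suc k) * abs_binom y (Suc k) \<le> real (Suc k) * abs_binom x (Suc k)"
    unfolding abs_binom_Suc
    using step assms by (intro mult_mono abs_binom_nonneg) auto
  then show ?case by simp
qed

text \<open>
  Convexity at \<open>\<alpha> = (1 - t) \<beta> + t \<gamma>\<close> with \<open>t = (3 \<alpha> - 1) / (2 \<alpha>)\<close>; the factor \<open>1 + \<alpha>\<close> accounts for
  the different values at \<open>k = 2\<close>.
\<close>
lemma abs_binom_convex:
  assumes "1/3 \<le> \<alpha>" "\<alpha> < 1" "2 \<le> k"
  shows "(1 + \<alpha>) * abs_binom \<alpha> k \<le>
    2 * (1 - \<alpha>) * abs_binom ((1 - \<alpha>) / 2) k + 2 * (3 * \<alpha> - 1) * abs_binom ((1 + \<alpha>) / 2) k"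
  using assms(3)
proof (induction k rule: dec_induct)
  case base
  then show ?case by (simp add: abs_binom_2 field_simps)
next
  case (step k)
  define A B C where "A = abs_binom \<alpha> k" and "B = abs_binom ((1 - \<alpha>) / 2) k"
    and "C = abs_binom ((1 + \<alpha>) / 2) k"
  have "C \<le> B"
    using abs_binom_reflect_le[of "(1 - \<alpha>) / 2" "(1 + \<alpha>) / 2" k] assms step by (simp add: B_def C_def field_simps)
  \<comment> \<open>The excess from replacing the factor k - \<alpha> by k - \<beta> on the
    \<open>B\<close> term and by k - \<gamma> on the \<open>C\<close> term, since \<alpha> - \<beta>
    = (3\<alpha> - 1)/2 and \<gamma> - \<alpha> = (1 - \<alpha>)/2.\<close>
  then have convex: "0 \<le> (1 - \<alpha>) * (3 * \<alpha> - 1) * (B - C)"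
    using assms by simp
  have IH: "(real k - \<alpha>) * ((1 + \<alpha>) * A) \<le>
      (real k - \<alpha>) * (2 * (1 - \<alpha>) * B + 2 * (3 * \<alpha> - 1) * C)"
    using step assms by (intro mult_left_mono) (auto simp: A_def B_def C_def)
  have "real (Suc k) * ((1 + \<alpha>) * abs_binom \<alpha> (Suc k)) = (real k - \<alpha>) * ((1 + \<alpha>) * A)"
    using abs_binom_Suc[of k \<alpha>] by (simp add: A_def mult.left_commute)
  also have "\<dots> \<le> (real k - \<alpha>) * (2 * (1 - \<alpha>) * B + 2 * (3 * \<alpha> - 1) * C)"
    by (rule IH)
  also have "\<dots> \<le> (real k - \<alpha>) * (2 * (1 - \<alpha>) * B + 2 * (3 * \<alpha> - 1) * C)
      + (1 - \<alpha>) * (3 * \<alpha> - 1) * (B - C)"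
    using convex by simp
  also have "\<dots> = 2 * (1 - \<alpha>) * ((real k - (1 - \<alpha>) / 2) * B)
      + 2 * (3 * \<alpha> - 1) * ((real k - (1 + \<alpha>) / 2) * C)"
    by (simp add: field_simps)
  also have "\<dots> = real (Suc k) * (2 * (1 - \<alpha>) * abs_binom ((1 - \<alpha>) / 2) (Suc k)
      + 2 * (3 * \<alpha> - 1) * abs_binom ((1 + \<alpha>) / 2) (Suc k))"
    unfolding B_def C_def abs_binom_Suc[symmetric] by (simp only: distrib_left mult_ac)
  finally show ?case
    by (simp only: mult_le_cancel_left_pos of_nat_0_less_iff zero_less_Suc)
qed

lemma hardy_coeff_abs_binom:
  "hardy_coeff \<alpha> k =
    (-1) ^ Suc k * abs_binom \<alpha> k + abs_binom ((1 - \<alpha>) / 2) k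
      - (-1) ^ Suc k * abs_binom ((1 + \<alpha>) / 2) k"
proof -
  have "(-1) ^ Suc k * abs_binom x k = (x gchoose k)" for x
    by (simp add: abs_binom_def flip: power_mult_distrib mult.assoc)
  then show ?thesis
    by (simp add: hardy_coeff_def abs_binom_def)
qed

text \<open>With \<open>A\<close>, \<open>B\<close>, \<open>C\<close> as below, the coefficient is A
  + B - C for odd \<open>k\<close>, settled by reflection, and B + C - A for even \<open>k\<close>,
  where convexity or \<alpha> = 0 enters.\<close>

lemma hardy_coeff_nonneg:
  assumes "\<alpha> \<in> {1/3..<1} \<union> {0}" "3 \<le> k"
  shows "0 \<le> hardy_coeff \<alpha> k"
proof -
  define A B C where "A = abs_binom \<alpha> k" and "B = abs_binom ((1 - \<alpha>) / 2) k"
    and "C = abs_binom ((1 + \<alpha>) / 2) k"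
  have CB: "C \<le> B"
    using abs_binom_reflect_le[of "(1 - \<alpha>) / 2" "(1 + \<alpha>) / 2" k] assms by (auto simp: B_def C_def field_simps)
  have nonneg: "0 \<le> A" "0 \<le> C"
    using assms by (auto simp: A_def C_def intro!: abs_binom_nonneg)
  have "A \<le> B + C"
  proof (cases "\<alpha> = 0")
    case True
    then have "A = 0"
      using assms by (cases k) (auto simp: A_def abs_binom_def)
    then show ?thesis using CB nonneg by simp
  next
    case False
    then have \<alpha>: "1/3 \<le> \<alpha>" "\<alpha> < 1"
      using assms by auto
    have "(1 + \<alpha>) * A \<le> 2 * (1 - \<alpha>) * B + 2 * (3 * \<alpha> - 1) * C"
      using abs_binom_convex \<alpha> assms by (simp add: A_def B_def C_def)
    also have "\<dots> = (1 + \<alpha>) * (B + C) - (3 * \<alpha> - 1) * (B - C) - (2 - 2 * \<alpha>) * C"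
      by (simp add: algebra_simps)
    also have "\<dots> \<le> (1 + \<alpha>) * (B + C)"
    proof -
      have "0 \<le> (3 * \<alpha> - 1) * (B - C)" "0 \<le> (2 - 2 * \<alpha>) * C"
        using \<alpha> CB nonneg by (auto intro!: mult_nonneg_nonneg)
      then show ?thesis by linarith
    qed
    finally show ?thesis using \<alpha> by simp
  qed
  then show ?thesis
    using CB nonneg unfolding hardy_coeff_abs_binom A_def B_def C_def
    by (cases "even k") auto
qed

section \<open>The weight and its power series\<close>

definition hardy_weight :: "real \<Rightarrow> real \<Rightarrow> real" where
  "hardy_weight \<alpha> x =
    1 + (1 + x) powr \<alpha> - (1 - x) powr ((1 - \<alpha>) / 2) - (1 + x) powr ((1 + \<alpha>) / 2)"

lemma hardy_weight_sums:
  assumes "\<bar>x\<bar> < 1"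
  shows "(\<lambda>k. hardy_coeff \<alpha> (k + 3) * x ^ (k + 3)) sums
    (hardy_weight \<alpha> x - (\<alpha> - 1)\<^sup>2 / 4 * x\<^sup>2)"
proof -
  have "(\<lambda>k. (\<alpha> gchoose k) * x ^ k - (((1 - \<alpha>) / 2) gchoose k) * (- x) ^ k
      - (((1 + \<alpha>) / 2) gchoose k) * x ^ k) sums
    ((1 + x) powr \<alpha> - (1 + - x) powr ((1 - \<alpha>) / 2) - (1 + x) powr ((1 + \<alpha>) / 2))"
    using assms by (intro sums_diff gen_binomial_real) auto
  moreover have "(\<alpha> gchoose k) * x ^ k - (((1 - \<alpha>) / 2) gchoose k) * (- x) ^ k
      - (((1 + \<alpha>) / 2) gchoose k) * x ^ k = hardy_coeff \<alpha> k * x ^ k" for k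
    by (simp add: hardy_coeff_def power_minus[of x] algebra_simps)
  ultimately have "(\<lambda>k. hardy_coeff \<alpha> k * x ^ k) sums (hardy_weight \<alpha> x - 1)"
    by (simp add: hardy_weight_def algebra_simps)
  then have "(\<lambda>k. hardy_coeff \<alpha> (k + 3) * x ^ (k + 3)) sums
      (hardy_weight \<alpha> x - 1 - (\<Sum>k<3. hardy_coeff \<alpha> k * x ^ k))"
    by (rule sums_split_initial_segment)
  \<comment> \<open>The linear coefficient is \<alpha> + \<beta> - \<gamma> = 0, and the constant -1
    cancels the summand 1 of the weight.\<close>
  moreover have "(\<Sum>k<3. hardy_coeff \<alpha> k * x ^ k) = (\<alpha> - 1)\<^sup>2 / 4 * x\<^sup>2 - 1"
  proof -
    have "hardy_coeff \<alpha> 0 = -1" "hardy_coeff \<alpha> 1 = 0"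
      by (simp_all add: hardy_coeff_def field_simps)
    moreover have "hardy_coeff \<alpha> 2 = (\<alpha> - 1)\<^sup>2 / 4"
      by (simp add: hardy_coeff_abs_binom abs_binom_2 field_simps power2_eq_square)
    ultimately show ?thesis
      by (simp add: eval_nat_numeral)
  qed
  ultimately show ?thesis by simp
qed

lemma hardy_weight_has_sum:
  assumes "\<alpha> \<in> {1/3..<1} \<union> {0}" "0 \<le> x" "x < 1"
  shows "((\<lambda>k. hardy_coeff \<alpha> k * x ^ k) has_sum (hardy_weight \<alpha> x - (\<alpha> - 1)\<^sup>2 / 4 * x\<^sup>2)) {3..}"
proof -
  have "((\<lambda>k. hardy_coeff \<alpha> (k + 3) * x ^ (k + 3)) has_sum
      (hardy_weight \<alpha> x - (\<alpha> - 1)\<^sup>2 / 4 * x\<^sup>2)) UNIV"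
    using assms hardy_weight_sums[of x \<alpha>] hardy_coeff_nonneg[OF assms(1)]
    by (intro sums_nonneg_imp_has_sum) auto
  moreover have "bij_betw (\<lambda>k::nat. k + 3) UNIV {3..}"
    by (rule bij_betwI[where g = "\<lambda>k. k - 3"]) auto
  ultimately show ?thesis
    using has_sum_reindex_bij_betw[of "\<lambda>k. k + 3" UNIV "{3..}" "\<lambda>k. hardy_coeff \<alpha> k * x ^ k"]
    by simp
qed

text \<open>By AM-GM for 2 and \<open>2 powr \<alpha>\<close>, the weight at 1 is at least
  \<open>2 powr \<alpha> / 2\<close>, hence at least 1/2, while the left side is at most
  1/4.\<close>

lemma hardy_weight_1_ge:
  assumes "0 \<le> \<alpha>" "\<alpha> < 1"
  shows "(\<alpha> - 1)\<^sup>2 / 4 \<le> hardy_weight \<alpha> 1"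
proof -
  have "2 powr ((1 + \<alpha>) / 2) = sqrt (2 * 2 powr \<alpha>)"
    by (simp add: powr_half_sqrt[symmetric] powr_powr powr_mult powr_add add_divide_distrib)
  also have "\<dots> \<le> (2 + 2 powr \<alpha>) / 2"
    by (rule arith_geo_mean_sqrt) auto
  finally have "2 powr \<alpha> / 2 \<le> hardy_weight \<alpha> 1"
    by (simp add: hardy_weight_def field_simps)
  moreover have "1 \<le> 2 powr \<alpha>"
    using assms by (simp add: ge_one_powr_ge_zero)
  moreover have "(\<alpha> - 1)\<^sup>2 \<le> 1"
    using assms by (simp add: abs_square_le_1)
  ultimately show ?thesis by linarith
qed

section \<open>The ground state inequality\<close>

text \<open>The difference of the two sides is a square, which vanishes when \<open>a\<close> and
  \<open>b\<close> are proportional to \<open>g\<close> and \<open>h\<close>.\<close>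

lemma ground_state_ineq:
  fixes a b g h :: real
  assumes "0 < g" "0 < h"
  shows "(1 - g / h) * b\<^sup>2 + (1 - h / g) * a\<^sup>2 \<le> (b - a)\<^sup>2"
proof -
  have "(b - a)\<^sup>2 - ((1 - g / h) * b\<^sup>2 + (1 - h / g) * a\<^sup>2) = (g * b - h * a)\<^sup>2 / (g * h)"
    using assms by (simp add: field_simps power2_eq_square)
  moreover have "0 \<le> (g * b - h * a)\<^sup>2 / (g * h)"
    using assms by simp
  ultimately show ?thesis by linarith
qed

text \<open>The extra term is the share of the weight at \<open>Suc N\<close> coming from the edge
  to \<open>N\<close>; the next edge supplies the rest. For \<open>N = 0\<close> both sides are
  \<open>(u 1)\<^sup>2\<close>, because \<open>0 powr \<beta> = 0\<close> and
  \<open>u 0 = 0\<close>.\<close>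

lemma ground_state_sum_ineq:
  fixes u :: "nat \<Rightarrow> real"
  assumes "\<alpha> < 1" "u 0 = 0"
  shows "(\<Sum>n=1..N. (u n)\<^sup>2 * real n powr \<alpha> * hardy_weight \<alpha> (1 / real n))
      + real (Suc N) powr \<alpha> * (1 - (1 - 1 / real (Suc N)) powr ((1 - \<alpha>) / 2)) * (u (Suc N))\<^sup>2
    \<le> (\<Sum>n=1..Suc N. (u n - u (n - 1))\<^sup>2 * real n powr \<alpha>)"
proof (induction N)
  case 0
  then show ?case using assms by simp
next
  case (Suc N)
  define m where "m = real (Suc N)"
  define \<beta> where "\<beta> = (1 - \<alpha>) / 2"
  define a b where "a = u (Suc N)" and "b = u (Suc (Suc N))"
  have m: "m > 0" "real (Suc (Suc N)) = m + 1"
    by (auto simp: m_def)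
  have ratio: "m powr \<beta> / (m + 1) powr \<beta> = (1 - 1 / (m + 1)) powr \<beta>"
    "(m + 1) powr \<beta> / m powr \<beta> = (1 + 1 / m) powr \<beta>"
    using m by (simp_all add: powr_divide[symmetric] field_simps)
  have scale: "(m + 1) powr \<alpha> = m powr \<alpha> * (1 + 1 / m) powr \<alpha>"
  proof -
    have "m + 1 = m * (1 + 1 / m)"
      using m by (simp add: field_simps)
    then have "(m + 1) powr \<alpha> = (m * (1 + 1 / m)) powr \<alpha>"
      by (rule arg_cong)
    also have "\<dots> = m powr \<alpha> * (1 + 1 / m) powr \<alpha>"
      by (rule powr_mult)
    finally show ?thesis .
  qed
  have comb: "(1 + 1 / m) powr \<alpha> * (1 + 1 / m) powr \<beta> = (1 + 1 / m) powr ((1 + \<alpha>) / 2)"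
    by (simp add: powr_add[symmetric] \<beta>_def field_simps)
  \<comment> \<open>The edge weight sits at the right endpoint m + 1; its share for the left
    endpoint is rewritten with \<open>m powr \<alpha>\<close>, using \<alpha> + \<beta> =
    \<gamma>.\<close>
  then have transfer: "(m + 1) powr \<alpha> * (1 - (m + 1) powr \<beta> / m powr \<beta>)
      = m powr \<alpha> * ((1 + 1 / m) powr \<alpha> - (1 + 1 / m) powr ((1 + \<alpha>) / 2))"
    unfolding ratio scale by (simp add: right_diff_distrib mult.assoc)
  have "(m + 1) powr \<alpha> * ((1 - m powr \<beta> / (m + 1) powr \<beta>) * b\<^sup>2
      + (1 - (m + 1) powr \<beta> / m powr \<beta>) * a\<^sup>2) \<le> (m + 1) powr \<alpha> * (b - a)\<^sup>2"
    using m by (intro mult_left_mono ground_state_ineq) auto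
  then have edge:
    "(m + 1) powr \<alpha> * (1 - (1 - 1 / (m + 1)) powr \<beta>) * b\<^sup>2
      + m powr \<alpha> * ((1 + 1 / m) powr \<alpha> - (1 + 1 / m) powr ((1 + \<alpha>) / 2)) * a\<^sup>2
      \<le> (b - a)\<^sup>2 * (m + 1) powr \<alpha>"
    unfolding transfer[symmetric] ratio(1)[symmetric] by (simp only: distrib_left mult_ac)
  have weight: "a\<^sup>2 * m powr \<alpha> * hardy_weight \<alpha> (1 / m) =
      m powr \<alpha> * (1 - (1 - 1 / m) powr \<beta>) * a\<^sup>2
      + m powr \<alpha> * ((1 + 1 / m) powr \<alpha> - (1 + 1 / m) powr ((1 + \<alpha>) / 2)) * a\<^sup>2"
    by (simp add: hardy_weight_def \<beta>_def algebra_simps)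
  have "(\<Sum>n=1..Suc N. (u n)\<^sup>2 * real n powr \<alpha> * hardy_weight \<alpha> (1 / real n))
      = (\<Sum>n=1..N. (u n)\<^sup>2 * real n powr \<alpha> * hardy_weight \<alpha> (1 / real n))
        + a\<^sup>2 * m powr \<alpha> * hardy_weight \<alpha> (1 / m)"
    by (simp add: a_def m_def)
  moreover have "(\<Sum>n=1..Suc (Suc N). (u n - u (n - 1))\<^sup>2 * real n powr \<alpha>)
      = (\<Sum>n=1..Suc N. (u n - u (n - 1))\<^sup>2 * real n powr \<alpha>) + (b - a)\<^sup>2 * (m + 1) powr \<alpha>"
    by (simp add: a_def b_def m_def add_ac)
  ultimately show ?case
    using Suc.IH edge weight
    unfolding m(2) m_def[symmetric] \<beta>_def[symmetric] a_def[symmetric] b_def[symmetric]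
    by linarith
qed

theorem corollary2p2:
  fixes \<alpha> :: real
  assumes "\<alpha> \<in> {1/3..<1} \<union> {0}"
  shows "(\<forall>k\<ge>3. hardy_coeff \<alpha> k \<ge> 0) \<and>
    (\<forall>u :: nat \<Rightarrow> real. finite {n. u n \<noteq> 0} \<longrightarrow> u 0 = 0 \<longrightarrow>
      (\<lambda>k. hardy_coeff \<alpha> k * (\<Sum>\<^sub>\<infinity>n\<in>{2..}. \<bar>u n\<bar>\<^sup>2 / real n ^ k * real n powr \<alpha>))
        summable_on {3..} \<and>
      (\<Sum>\<^sub>\<infinity>n\<in>{1..}. \<bar>u n - u (n - 1)\<bar>\<^sup>2 * real n powr \<alpha>)
        \<ge> (\<alpha> - 1)\<^sup>2 / 4 * (\<Sum>\<^sub>\<infinity>n\<in>{1..}. \<bar>u n\<bar>\<^sup>2 / (real n)\<^sup>2 * real n powr \<alpha>)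
          + (\<Sum>\<^sub>\<infinity>k\<in>{3..}. hardy_coeff \<alpha> k *
              (\<Sum>\<^sub>\<infinity>n\<in>{2..}. \<bar>u n\<bar>\<^sup>2 / real n ^ k * real n powr \<alpha>)))"
proof (intro conjI allI impI)
  fix k :: nat
  assume "3 \<le> k"
  then show "0 \<le> hardy_coeff \<alpha> k"
    using assms by (rule hardy_coeff_nonneg[rotated])
next
  fix u :: "nat \<Rightarrow> real"
  assume fin: "finite {n. u n \<noteq> 0}" and u0: "u 0 = 0"
  have \<alpha>: "0 \<le> \<alpha>" "\<alpha> < 1"
    using assms by auto
  obtain M where M: "\<And>n. u n \<noteq> 0 \<Longrightarrow> n \<le> M"
    using fin unfolding finite_nat_set_iff_bounded_le by auto
  \<comment> \<open>The successor ensures that 1 lies in \<open>{1..N}\<close>, as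
    \<open>split\<close> requires.\<close>
  define N where "N = Suc M"
  have vanish: "u n = 0" if "n > N" for n
    using M[of n] that by (force simp: N_def)
  have inner: "(\<Sum>\<^sub>\<infinity>n\<in>{i..}. \<bar>u n\<bar>\<^sup>2 / real n ^ k * real n powr \<alpha>)
      = (\<Sum>n=i..N. (u n)\<^sup>2 / real n ^ k * real n powr \<alpha>)" for i k
  proof -
    have "(\<Sum>\<^sub>\<infinity>n\<in>{i..}. \<bar>u n\<bar>\<^sup>2 / real n ^ k * real n powr \<alpha>)
      = (\<Sum>\<^sub>\<infinity>n\<in>{i..N}. (u n)\<^sup>2 / real n ^ k * real n powr \<alpha>)"
      by (rule infsum_cong_neutral) (auto simp: vanish)
    then show ?thesis by simp
  qed
  have energy: "(\<Sum>\<^sub>\<infinity>n\<in>{1..}. \<bar>u n - u (n - 1)\<bar>\<^sup>2 * real n powr \<alpha>)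
      = (\<Sum>n=1..Suc N. (u n - u (n - 1))\<^sup>2 * real n powr \<alpha>)"
  proof -
    have "(\<Sum>\<^sub>\<infinity>n\<in>{1..}. \<bar>u n - u (n - 1)\<bar>\<^sup>2 * real n powr \<alpha>)
      = (\<Sum>\<^sub>\<infinity>n\<in>{1..Suc N}. (u n - u (n - 1))\<^sup>2 * real n powr \<alpha>)"
      by (rule infsum_cong_neutral) (auto simp: vanish)
    then show ?thesis by simp
  qed
  define c where "c n = (u n)\<^sup>2 * real n powr \<alpha>" for n
  define R where "R = (\<Sum>n=2..N. c n * (hardy_weight \<alpha> (1 / real n) - (\<alpha> - 1)\<^sup>2 / 4 * (1 / real n)\<^sup>2))"
  have "((\<lambda>k. \<Sum>n=2..N. c n * (hardy_coeff \<alpha> k * (1 / real n) ^ k)) has_sum R) {3..}"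
    unfolding R_def
  proof (rule has_sum_sum, rule has_sum_cmult_right)
    fix n assume "n \<in> {2..N}"
    then show "((\<lambda>k. hardy_coeff \<alpha> k * (1 / real n) ^ k) has_sum
        (hardy_weight \<alpha> (1 / real n) - (\<alpha> - 1)\<^sup>2 / 4 * (1 / real n)\<^sup>2)) {3..}"
      by (intro hardy_weight_has_sum[OF assms]) auto
  qed
  moreover have "(\<Sum>n=2..N. c n * (hardy_coeff \<alpha> k * (1 / real n) ^ k))
      = hardy_coeff \<alpha> k * (\<Sum>\<^sub>\<infinity>n\<in>{2..}. \<bar>u n\<bar>\<^sup>2 / real n ^ k * real n powr \<alpha>)" for k
    unfolding inner sum_distrib_left
    by (intro sum.cong) (auto simp: c_def power_divide)
  ultimately have R: "((\<lambda>k. hardy_coeff \<alpha> k *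
      (\<Sum>\<^sub>\<infinity>n\<in>{2..}. \<bar>u n\<bar>\<^sup>2 / real n ^ k * real n powr \<alpha>)) has_sum R) {3..}"
    by simp
  then show "(\<lambda>k. hardy_coeff \<alpha> k * (\<Sum>\<^sub>\<infinity>n\<in>{2..}. \<bar>u n\<bar>\<^sup>2 / real n ^ k * real n powr \<alpha>))
      summable_on {3..}"
    by (rule has_sum_imp_summable)
  have split: "{1..N} = insert 1 {2..N}"
    by (auto simp: N_def)
  have "(\<Sum>n=1..N. (u n)\<^sup>2 / (real n)\<^sup>2 * real n powr \<alpha>)
      = c 1 + (\<Sum>n=2..N. c n * (1 / real n)\<^sup>2)"
    unfolding split by (simp add: c_def power_divide)
  moreover have "R = (\<Sum>n=2..N. c n * hardy_weight \<alpha> (1 / real n))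
      - (\<alpha> - 1)\<^sup>2 / 4 * (\<Sum>n=2..N. c n * (1 / real n)\<^sup>2)"
    unfolding R_def sum_distrib_left sum_subtractf[symmetric]
    by (intro sum.cong) (simp_all only: right_diff_distrib mult.left_commute)
  ultimately have "(\<alpha> - 1)\<^sup>2 / 4 * (\<Sum>n=1..N. (u n)\<^sup>2 / (real n)\<^sup>2 * real n powr \<alpha>) + R
      = (\<alpha> - 1)\<^sup>2 / 4 * c 1 + (\<Sum>n=2..N. c n * hardy_weight \<alpha> (1 / real n))"
    by (simp add: distrib_left)
  \<comment> \<open>The series in \<open>k\<close> starts at \<open>n = 2\<close>, so the weight at
    \<open>n = 1\<close> only has to dominate the quadratic term.\<close>
  also have "\<dots> \<le> hardy_weight \<alpha> 1 * c 1 + (\<Sum>n=2..N. c n * hardy_weight \<alpha> (1 / real n))"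
    using hardy_weight_1_ge[OF \<alpha>] by (intro add_right_mono mult_right_mono) (auto simp: c_def)
  also have "\<dots> = (\<Sum>n=1..N. (u n)\<^sup>2 * real n powr \<alpha> * hardy_weight \<alpha> (1 / real n))"
    unfolding split by (simp add: c_def)
  \<comment> \<open>The boundary term drops out because \<open>u (Suc N) = 0\<close>.\<close>
  also have "\<dots> \<le> (\<Sum>n=1..Suc N. (u n - u (n - 1))\<^sup>2 * real n powr \<alpha>)"
    using ground_state_sum_ineq[of \<alpha> u N] \<alpha> u0 by (simp add: vanish)
  finally show "(\<Sum>\<^sub>\<infinity>n\<in>{1..}. \<bar>u n - u (n - 1)\<bar>\<^sup>2 * real n powr \<alpha>)
        \<ge> (\<alpha> - 1)\<^sup>2 / 4 * (\<Sum>\<^sub>\<infinity>n\<in>{1..}. \<bar>u n\<bar>\<^sup>2 / (real n)\<^sup>2 * real n powr \<alpha>)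
          + (\<Sum>\<^sub>\<infinity>k\<in>{3..}. hardy_coeff \<alpha> k *
              (\<Sum>\<^sub>\<infinity>n\<in>{2..}. \<bar>u n\<bar>\<^sup>2 / real n ^ k * real n powr \<alpha>))"
    unfolding inner[where i = 1 and k = 2] energy infsumI[OF R] .
qed

end
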